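(* Let $\mathcal{T}:\mathbf{Set}^{\mathrm{op}}\to\mathbf{Set}$ be the functor sending a set $A$ to the set of all topologies $\tau\subseteq 2^A$ on $A$, and a map $f:A\to B$ to $\mathcal{T}(B)\to\mathcal{T}(A)$, $\tau_B\mapsto\{f^{-1}(U)\mid U\in\tau_B\}$. Equip $\mathbf{Set}$ with the bicoverings given by cospans $A\to C\leftarrow B$ of injective maps that are jointly surjective; regard $A,B$ as subsets of $C$, so $A\cup B=C$ and $A\times_C B=A\cap B$. For such a bicovering define $g:\mathcal{T}(A)\times_{\mathcal{T}(A\cap B)}\mathcal{T}(B)\to\mathcal{T}(C)$ by $$g(\tau_A,\tau_B):=\{U\subseteq C\mid U\cap A\in\tau_A,\ U\cap B\in\tau_B\}.$$ With these definitions, $(\mathcal{T},g)$ is a gleaf.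
   Context: **Morphisms of bicoverings.** The cospans named in the claim form a system of bicoverings on $\mathbf{Set}$; the two legs are not distinguished. A morphism of bicoverings from $a'\to c'\leftarrow b'$ to $a\to c\leftarrow b$ consists of $q_a:a'\to a$, $q_b:b'\to b$, $q_c:c'\to c$ commuting with the legs, such that the induced map $a'\times_{c'}b'\to a\times_c b$ has a right inverse. **Gleaves.** A $\mathbf{Set}$-valued gleaf on a category $\mathsf{C}$ with a system of bicoverings is a functor $\Gamma:\mathsf{C}^{\mathrm{op}}\to\mathbf{Set}$ together with a map $g:\Gamma(a)\times_{\Gamma(a\times_c b)}\Gamma(b)\to\Gamma(c)$ for every bicovering $a\to c\leftarrow b$ (independent, up to swapping arguments, of the order of the legs), such that: 1. (Identity) for a bicovering $a=a\leftarrow b$, $g=\pi_1:\Gamma(a)\times_{\Gamma(b)}\Gamma(b)\to\Gamma(a)$; for a bicovering $a\to b=b$, $g=\pi_2:\Gamma(a)\times_{\Gamma(a)}\Gamma(b)\to\Gamma(b)$. 2. (Back-and-forth) given bicoverings $a\to c\leftarrow b$ and $a'\to a\leftarrow a\times_c b$, the composite $\Gamma(a')\times_{\Gamma(a'\times_c b)}\Gamma(b)\xrightarrow{g}\Gamma(c)\to\Gamma(a)\times_{\Gamma(a\times_c b)}\Gamma(b)\xrightarrow{g}\Gamma(c)$ (middle arrow: restriction) equals $g:\Gamma(a')\times_{\Gamma(a'\times_c b)}\Gamma(b)\to\Gamma(c)$ (for the composed bicovering $a'\to c\leftarrow b$). 3. (Partial naturality) for every morphism of bicoverings $(q_a,q_b,q_c)$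 from $a'\to c'\leftarrow b'$ to $a\to c\leftarrow b$, $\Gamma(q_c)\circ g=g\circ(\Gamma(q_a)\times\Gamma(q_b))$ as maps $\Gamma(a)\times_{\Gamma(a\times_c b)}\Gamma(b)\to\Gamma(c')$. *)

theory Defs
  imports "HOL-Analysis.Abstract_Topology" "HOL-Library.FuncSet"
begin

record ('o, 'm) cat =
  Obj :: "'o set"
  Arr :: "'m set"
  Src :: "'m \<Rightarrow> 'o"
  Tgt :: "'m \<Rightarrow> 'o"
  Ident :: "'o \<Rightarrow> 'm"
  Comp :: "'m \<Rightarrow> 'm \<Rightarrow> 'm"  (infixr \<open>\<odot>\<index>\<close> 70)

locale category =
  fixes C :: "('o, 'm) cat" (structure)
  assumes Src_Obj: "f \<in> Arr C \<Longrightarrow> Src C f \<in> Obj C"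
    and Tgt_Obj: "f \<in> Arr C \<Longrightarrow> Tgt C f \<in> Obj C"
    and Ident_Arr: "a \<in> Obj C \<Longrightarrow>
      Ident C a \<in> Arr C \<and> Src C (Ident C a) = a \<and> Tgt C (Ident C a) = a"
    and Comp_Arr: "f \<in> Arr C \<Longrightarrow> g \<in> Arr C \<Longrightarrow> Tgt C f = Src C g \<Longrightarrow>
      g \<odot> f \<in> Arr C \<and> Src C (g \<odot> f) = Src C f \<and> Tgt C (g \<odot> f) = Tgt C g"
    and Comp_Ident_right: "f \<in> Arr C \<Longrightarrow> f \<odot> Ident C (Src C f) = f"
    and Comp_Ident_left: "f \<in> Arr C \<Longrightarrow> Ident C (Tgt C f) \<odot> f = f"
    and Comp_assoc: "f \<in> Arr C \<Longrightarrow> g \<in> Arr C \<Longrightarrow> h \<in> Arr C \<Longrightarrow>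
      Tgt C f = Src C g \<Longrightarrow> Tgt C g = Src C h \<Longrightarrow> (h \<odot> g) \<odot> f = h \<odot> (g \<odot> f)"

definition is_cospan :: "('o, 'm) cat \<Rightarrow> 'm \<Rightarrow> 'm \<Rightarrow> bool" where
  "is_cospan C f h \<longleftrightarrow> f \<in> Arr C \<and> h \<in> Arr C \<and> Tgt C f = Tgt C h"

definition is_span_over :: "('o, 'm) cat \<Rightarrow> 'm \<Rightarrow> 'm \<Rightarrow> 'm \<Rightarrow> 'm \<Rightarrow> bool" where
  "is_span_over C f h p q \<longleftrightarrow>
     p \<in> Arr C \<and> q \<in> Arr C \<and> Src C p = Src C q \<and>
     Tgt C p = Src C f \<and> Tgt C q = Src C h \<and> Comp C f p = Comp C h q"

definition is_pullback :: "('o, 'm) cat \<Rightarrow> 'm \<Rightarrow> 'm \<Rightarrow> 'm \<Rightarrow> 'm \<Rightarrow> bool" where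
  "is_pullback C f h p q \<longleftrightarrow>
     is_cospan C f h \<and> is_span_over C f h p q \<and>
     (\<forall>r s. is_span_over C f h r s \<longrightarrow>
        (\<exists>!u. u \<in> Arr C \<and> Src C u = Src C r \<and> Tgt C u = Src C p \<and>
              Comp C p u = r \<and> Comp C q u = s))"

text \<open>Bicoverings come with exactly the structure that the notion of a gleaf refers to: the two
  legs are interchangeable, \<open>a \<times>\<^sub>c b\<close> exists, and bicoverings
  \<open>a \<rightarrow> c \<leftarrow> b\<close> and \<open>a' \<rightarrow> a \<leftarrow> a \<times>\<^sub>c b\<close> compose to a bicovering
  \<open>a' \<rightarrow> c \<leftarrow> b\<close>. Pullbacks are not chosen: all pullback squares are treated alike.\<close>

locale bicovered_category = category C
  for C :: "('o, 'm) cat" (structure) +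
  fixes bicov :: "'m \<Rightarrow> 'm \<Rightarrow> bool"
  assumes bicov_cospan: "bicov f h \<Longrightarrow> is_cospan C f h"
    and bicov_swap: "bicov f h \<Longrightarrow> bicov h f"
    and bicov_pullback: "bicov f h \<Longrightarrow> \<exists>p q. is_pullback C f h p q"
    and bicov_comp: "bicov f h \<Longrightarrow> is_pullback C f h p q \<Longrightarrow> bicov f' p \<Longrightarrow> bicov (f \<odot> f') h"

text \<open>\<open>bicov_morphism C f' h' f h q\<^sub>a q\<^sub>b q\<^sub>c\<close>: a morphism of bicoverings from
  \<open>a' -f'\<rightarrow> c' \<leftarrow>h'- b'\<close> to \<open>a -f\<rightarrow> c \<leftarrow>h- b\<close>. The arrow \<open>u\<close> is the induced map
  \<open>a' \<times>\<^sub>c\<^sub>' b' \<rightarrow> a \<times>\<^sub>c b\<close>; whether it has a right inverse does not depend on the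
  pullbacks used.\<close>

definition bicov_morphism ::
  "('o, 'm) cat \<Rightarrow> 'm \<Rightarrow> 'm \<Rightarrow> 'm \<Rightarrow> 'm \<Rightarrow> 'm \<Rightarrow> 'm \<Rightarrow> 'm \<Rightarrow> bool" where
  "bicov_morphism C f' h' f h qa qb qc \<longleftrightarrow>
     qa \<in> Arr C \<and> Src C qa = Src C f' \<and> Tgt C qa = Src C f \<and>
     qb \<in> Arr C \<and> Src C qb = Src C h' \<and> Tgt C qb = Src C h \<and>
     qc \<in> Arr C \<and> Src C qc = Tgt C f' \<and> Tgt C qc = Tgt C f \<and>
     Comp C qc f' = Comp C f qa \<and> Comp C qc h' = Comp C h qb \<and>
     (\<exists>p' q' p q u s.
        is_pullback C f' h' p' q' \<and> is_pullback C f h p q \<and>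
        u \<in> Arr C \<and> Src C u = Src C p' \<and> Tgt C u = Src C p \<and>
        Comp C p u = Comp C qa p' \<and> Comp C q u = Comp C qb q' \<and>
        s \<in> Arr C \<and> Src C s = Src C p \<and> Tgt C s = Src C p' \<and>
        Comp C u s = Ident C (Src C p))"

text \<open>A functor \<open>C\<^sup>o\<^sup>p \<rightarrow> Set\<close> is given by its sets \<open>GO a\<close> and by maps \<open>GM f\<close>, of which only
  the restriction to \<open>GO (Tgt C f)\<close> is relevant.\<close>

locale set_presheaf = category C
  for C :: "('o, 'm) cat" (structure) +
  fixes GO :: "'o \<Rightarrow> 'v set" and GM :: "'m \<Rightarrow> 'v \<Rightarrow> 'v"
  assumes GM_maps: "f \<in> Arr C \<Longrightarrow> GM f \<in> GO (Tgt C f) \<rightarrow> GO (Src C f)"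
    and GM_Ident: "a \<in> Obj C \<Longrightarrow> x \<in> GO a \<Longrightarrow> GM (Ident C a) x = x"
    and GM_Comp: "f \<in> Arr C \<Longrightarrow> g \<in> Arr C \<Longrightarrow> Tgt C f = Src C g \<Longrightarrow> x \<in> GO (Tgt C g) \<Longrightarrow>
      GM (g \<odot> f) x = GM f (GM g x)"

text \<open>The fibre product \<open>\<Gamma>(a) \<times> \<Gamma>(b)\<close> over \<open>\<Gamma>(a \<times>\<^sub>c b)\<close>, for the cospan
  \<open>a -f\<rightarrow> c \<leftarrow>h- b\<close>. Since pullbacks are unique up to isomorphism, it makes no difference
  whether one or every pullback is tested.\<close>

definition matching ::
  "('o, 'm) cat \<Rightarrow> ('o \<Rightarrow> 'v set) \<Rightarrow> ('m \<Rightarrow> 'v \<Rightarrow> 'v) \<Rightarrow> 'm \<Rightarrow> 'm \<Rightarrow> ('v \<times> 'v) set" where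
  "matching C GO GM f h =
     {(x, y). x \<in> GO (Src C f) \<and> y \<in> GO (Src C h) \<and>
              (\<forall>p q. is_pullback C f h p q \<longrightarrow> GM p x = GM q y)}"

locale gleaf = bicovered_category C bicov + set_presheaf C GO GM
  for C :: "('o, 'm) cat" (structure)
    and bicov :: "'m \<Rightarrow> 'm \<Rightarrow> bool"
    and GO :: "'o \<Rightarrow> 'v set"
    and GM :: "'m \<Rightarrow> 'v \<Rightarrow> 'v" +
  fixes glue :: "'m \<Rightarrow> 'm \<Rightarrow> 'v \<times> 'v \<Rightarrow> 'v"
  assumes glue_maps: "bicov f h \<Longrightarrow> glue f h \<in> matching C GO GM f h \<rightarrow> GO (Tgt C f)"
    and glue_swap: "bicov f h \<Longrightarrow> (x, y) \<in> matching C GO GM f h \<Longrightarrow>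
      glue h f (y, x) = glue f h (x, y)"
    and glue_identity_left: "a \<in> Obj C \<Longrightarrow> bicov (Ident C a) h \<Longrightarrow>
      (x, y) \<in> matching C GO GM (Ident C a) h \<Longrightarrow> glue (Ident C a) h (x, y) = x"
    and glue_identity_right: "b \<in> Obj C \<Longrightarrow> bicov f (Ident C b) \<Longrightarrow>
      (x, y) \<in> matching C GO GM f (Ident C b) \<Longrightarrow> glue f (Ident C b) (x, y) = y"
    and glue_back_and_forth: "bicov f h \<Longrightarrow> is_pullback C f h p q \<Longrightarrow> bicov f' p \<Longrightarrow>
      (x, y) \<in> matching C GO GM (f \<odot> f') h \<Longrightarrow>
      glue f h (GM f (glue (f \<odot> f') h (x, y)), GM h (glue (f \<odot> f') h (x, y)))
        = glue (f \<odot> f') h (x, y)"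
    and glue_partial_naturality: "bicov f' h' \<Longrightarrow> bicov f h \<Longrightarrow>
      bicov_morphism C f' h' f h qa qb qc \<Longrightarrow> (x, y) \<in> matching C GO GM f h \<Longrightarrow>
      GM qc (glue f h (x, y)) = glue f' h' (GM qa x, GM qb y)"

text \<open>The objects are all subsets of an arbitrary type \<open>'u\<close>, which plays the role of the universe;
  an arrow is a triple (source, map, target) whose map is extensional.\<close>

type_synonym 'u set_arr = "'u set \<times> ('u \<Rightarrow> 'u) \<times> 'u set"

definition set_cat :: "('u set, 'u set_arr) cat" where
  "set_cat = \<lparr>
     Obj = UNIV,
     Arr = {(A, f, B). f \<in> A \<rightarrow>\<^sub>E B},
     Src = (\<lambda>(A, f, B). A),
     Tgt = (\<lambda>(A, f, B). B),
     Ident = (\<lambda>A. (A, (\<lambda>x\<in>A. x), A)),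
     Comp = (\<lambda>(B, g, C) (A, f, B'). (A, compose A g f, C))\<rparr>"

definition set_bicov :: "'u set_arr \<Rightarrow> 'u set_arr \<Rightarrow> bool" where
  "set_bicov = (\<lambda>(A, i, C) (B, j, C').
     is_cospan set_cat (A, i, C) (B, j, C') \<and>
     inj_on i A \<and> inj_on j B \<and> i ` A \<union> j ` B = C)"

definition topologies :: "'u set \<Rightarrow> 'u set set set" where
  "topologies A = {\<tau>. \<tau> \<subseteq> Pow A \<and> A \<in> \<tau> \<and> istopology (\<lambda>U. U \<in> \<tau>)}"

definition topology_preimage :: "'u set_arr \<Rightarrow> 'u set set \<Rightarrow> 'u set set" where
  "topology_preimage = (\<lambda>(A, f, B) \<tau>. {f -` U \<inter> A | U. U \<in> \<tau>})"

text \<open>With \<open>A\<close> and \<open>B\<close> regarded as subsets of \<open>C\<close> along the injections \<open>i\<close> and \<open>j\<close>, the sets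
  \<open>U \<inter> A\<close> and \<open>U \<inter> B\<close> are the preimages of \<open>U\<close> under \<open>i\<close> and \<open>j\<close>.\<close>

definition topology_glue ::
  "'u set_arr \<Rightarrow> 'u set_arr \<Rightarrow> 'u set set \<times> 'u set set \<Rightarrow> 'u set set" where
  "topology_glue = (\<lambda>(A, i, C) (B, j, C') (\<tau>A, \<tau>B).
     {U. U \<subseteq> C \<and> i -` U \<inter> A \<in> \<tau>A \<and> j -` U \<inter> B \<in> \<tau>B})"

end

theory Submission
  imports Defs
begin

text \<open>
  Regard the legs of a bicovering as inclusions of \<open>A\<close> and \<open>B\<close> into \<open>C = A \<union> B\<close>. A subset \<open>U\<close> of
  \<open>C\<close> is then the same thing as a pair of subsets of \<open>A\<close> and of \<open>B\<close> with the same trace on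
  \<open>A \<inter> B\<close>, and the glued topology consists of the \<open>U\<close> for which both traces are open. It is a
  topology because traces commute with intersections and unions.

  For the back-and-forth axiom, let \<open>W\<close> be the topology glued from \<open>A' \<subseteq> A\<close> and \<open>B\<close>. If \<open>U\<close>
  agrees on \<open>A\<close> with one member of \<open>W\<close> and on \<open>B\<close> with another, then its traces on \<open>A'\<close> and \<open>B\<close>
  are open, so that \<open>U\<close> is itself in \<open>W\<close>.

  The axiom with most content is partial naturality: every \<open>V \<subseteq> C'\<close> whose traces on \<open>A'\<close>
  and \<open>B'\<close> are preimages of open sets \<open>S \<subseteq> A\<close> and \<open>T \<subseteq> B\<close> has to be the preimage of a single set
  that is open in the glued topology. The candidate is \<open>S \<union> T\<close>, and it works as soon as \<open>S\<close> and \<open>T\<close>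
  agree on \<open>A \<inter> B\<close>. Their preimages in \<open>A' \<inter> B'\<close> do agree, both being the trace of \<open>V\<close>; and
  \<open>A' \<inter> B' \<rightarrow> A \<inter> B\<close> is surjective because it has a right inverse. This is where that part of the
  definition of a morphism of bicoverings enters; it is extracted as
  \<open>bicov_morphism_lifts_overlap\<close>.

  Pullbacks are only given by their universal property. To speak of their elements, one maps
  one-element sets into them (\<open>set_pullback_element\<close>).
\<close>

section \<open>Pullbacks in a category\<close>

lemma is_pullback_factor:
  assumes "is_pullback C f h p q" "is_span_over C f h r s"
  shows "\<exists>u. u \<in> Arr C \<and> Src C u = Src C r \<and> Tgt C u = Src C p \<and> Comp C p u = r \<and> Comp C q u = s"
  using assms(1)[unfolded is_pullback_def, THEN conjunct2, THEN conjunct2, rule_format, OF assms(2)]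
  by (rule ex1_implies_ex)

lemma is_pullback_swap:
  assumes "is_pullback C f h p q"
  shows "is_pullback C h f q p"
proof -
  have span: "is_span_over C h f s r \<longleftrightarrow> is_span_over C f h r s" for r s
    by (auto simp: is_span_over_def)
  have uni: "\<exists>!u. u \<in> Arr C \<and> Src C u = Src C r \<and> Tgt C u = Src C q \<and> Comp C q u = r \<and> Comp C p u = s"
    if "is_span_over C h f r s" for r s
  proof -
    have "is_span_over C f h s r" using that span by blast
    with assms have "\<exists>!u. u \<in> Arr C \<and> Src C u = Src C s \<and> Tgt C u = Src C p \<and>
        Comp C p u = s \<and> Comp C q u = r"
      by (simp add: is_pullback_def)
    moreover have "Src C p = Src C q" "Src C s = Src C r"
      using assms that by (simp_all add: is_pullback_def is_span_over_def)
    ultimately show ?thesis by (simp add: conj_commute conj_left_commute)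
  qed
  show ?thesis
    unfolding is_pullback_def[of C h f]
    using assms span uni by (simp add: is_pullback_def is_cospan_def)
qed

lemma matching_swap: "(x, y) \<in> matching C GO GM f h \<Longrightarrow> (y, x) \<in> matching C GO GM h f"
  by (auto simp: matching_def dest: is_pullback_swap)

lemma (in category) pullback_of_identity:
  assumes h: "h \<in> Arr C"
  shows "is_pullback C (Ident C (Tgt C h)) h h (Ident C (Src C h))"
  unfolding is_pullback_def
proof (intro conjI allI impI)
  note I = Ident_Arr[OF Src_Obj[OF h]] Ident_Arr[OF Tgt_Obj[OF h]]
  show "is_cospan C (Ident C (Tgt C h)) h"
    using h I by (simp add: is_cospan_def)
  show "is_span_over C (Ident C (Tgt C h)) h h (Ident C (Src C h))"
    using h I Comp_Ident_left[OF h] Comp_Ident_right[OF h] by (simp add: is_span_over_def)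
  fix r s assume "is_span_over C (Ident C (Tgt C h)) h r s"
  then have rs: "r \<in> Arr C" "s \<in> Arr C" "Src C r = Src C s" "Tgt C r = Tgt C h"
      "Tgt C s = Src C h" "Comp C (Ident C (Tgt C h)) r = Comp C h s"
    using I by (auto simp: is_span_over_def)
  have hs: "Comp C h s = r" using rs(4,6) Comp_Ident_left[OF rs(1)] by simp
  have id: "Comp C (Ident C (Src C h)) u = u" if "u \<in> Arr C" "Tgt C u = Src C h" for u
    using Comp_Ident_left[OF that(1)] that(2) by simp
  show "\<exists>!u. u \<in> Arr C \<and> Src C u = Src C r \<and> Tgt C u = Src C h \<and>
      Comp C h u = r \<and> Comp C (Ident C (Src C h)) u = s"
    using rs(2,3,5) hs id by metis
qed

section \<open>The category of sets\<close>

lemma set_cat_simps [simp]: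
  "Obj set_cat = UNIV"
  "(A, f, B) \<in> Arr set_cat \<longleftrightarrow> f \<in> A \<rightarrow>\<^sub>E B"
  "Src set_cat (A, f, B) = A"
  "Tgt set_cat (A, f, B) = B"
  "Ident set_cat A = (A, (\<lambda>x\<in>A. x), A)"
  "Comp set_cat (B, g, D) (A, f, B') = (A, compose A g f, D)"
  by (simp_all add: set_cat_def)

lemma compose_in_extensional_funcset:
  "f \<in> A \<rightarrow>\<^sub>E B \<Longrightarrow> g \<in> B \<rightarrow>\<^sub>E D \<Longrightarrow> compose A g f \<in> A \<rightarrow>\<^sub>E D"
  by (auto simp: compose_def)

lemma category_set_cat: "category (set_cat :: ('u set, 'u set_arr) cat)"
proof
  fix f g h :: "'u set_arr"
  obtain A F B where f: "f = (A, F, B)" by (cases f)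
  obtain B' G D where g: "g = (B', G, D)" by (cases g)
  obtain D' H E where h: "h = (D', H, E)" by (cases h)
  show "Src set_cat f \<in> Obj set_cat" "Tgt set_cat f \<in> Obj set_cat" by simp_all
  {
    assume fA: "f \<in> Arr set_cat"
    show "Comp set_cat f (Ident set_cat (Src set_cat f)) = f"
      using fA f by (auto simp: PiE_def intro!: compose_Id)
    show "Comp set_cat (Ident set_cat (Tgt set_cat f)) f = f"
      using fA f by (auto simp: PiE_def intro!: Id_compose)
    assume gA: "g \<in> Arr set_cat" and fg: "Tgt set_cat f = Src set_cat g"
    show "Comp set_cat g f \<in> Arr set_cat \<and> Src set_cat (Comp set_cat g f) = Src set_cat f \<and>
        Tgt set_cat (Comp set_cat g f) = Tgt set_cat g"
      using fA gA fg f g by (simp add: compose_in_extensional_funcset)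
    assume "h \<in> Arr set_cat" "Tgt set_cat g = Src set_cat h"
    then show "Comp set_cat (Comp set_cat h g) f = Comp set_cat h (Comp set_cat g f)"
      using fA gA fg f g h by (auto simp: PiE_def intro!: compose_assoc[symmetric])
  }
  show "Ident set_cat a \<in> Arr set_cat \<and> Src set_cat (Ident set_cat a) = a \<and>
      Tgt set_cat (Ident set_cat a) = a" for a :: "'u set"
    by simp
qed

text \<open>The span \<open>A \<leftarrow> {a} \<rightarrow> B\<close> that picks out \<open>a\<close> and \<open>b\<close> factors through the pullback; the image
  of the point is the required element.\<close>

lemma set_pullback_element:
  fixes f h :: "'u \<Rightarrow> 'u"
  assumes pb: "is_pullback set_cat (A, f, C) (B, h, C') (P, p, A') (Q, q, B')"
    and ab: "a \<in> A" "b \<in> B" "f a = h b"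
  obtains t where "t \<in> P" "p t = a" "q t = b"
proof -
  have "is_span_over set_cat (A, f, C) (B, h, C') ({a}, \<lambda>x\<in>{a}. a, A) ({a}, \<lambda>x\<in>{a}. b, B)"
    using ab pb
    by (auto simp: is_span_over_def is_pullback_def is_cospan_def compose_def fun_eq_iff)
  from is_pullback_factor[OF pb this] obtain k where
      "k \<in> Arr set_cat" "Src set_cat k = {a}" "Tgt set_cat k = P"
      "Comp set_cat (P, p, A') k = ({a}, \<lambda>x\<in>{a}. a, A)"
      "Comp set_cat (Q, q, B') k = ({a}, \<lambda>x\<in>{a}. b, B)"
    unfolding set_cat_simps by blast
  note k = this
  obtain K u L where K: "k = (K, u, L)" by (cases k)
  have u: "u a \<in> P" "compose {a} p u = (\<lambda>x\<in>{a}. a)" "compose {a} q u = (\<lambda>x\<in>{a}. b)"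
    using k K by auto
  from u(2,3)[THEN fun_cong, of a] have "p (u a) = a" "q (u a) = b"
    by (simp_all add: compose_def)
  with u(1) that show thesis by blast
qed

lemma set_pullback_commutes:
  assumes "is_pullback set_cat (A, f, C) (B, h, C') (P, p, A') (Q, q, B')"
  shows "Q = P" "A' = A" "B' = B" "p \<in> P \<rightarrow>\<^sub>E A" "q \<in> P \<rightarrow>\<^sub>E B" "\<And>t. t \<in> P \<Longrightarrow> f (p t) = h (q t)"
proof -
  show "Q = P" "A' = A" "B' = B" "p \<in> P \<rightarrow>\<^sub>E A" "q \<in> P \<rightarrow>\<^sub>E B"
    using assms by (auto simp: is_pullback_def is_span_over_def)
  fix t assume t: "t \<in> P"
  have "compose P f p = compose P h q"
    using assms by (auto simp: is_pullback_def is_span_over_def)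
  from fun_cong[OF this, of t] t show "f (p t) = h (q t)" by (simp add: compose_def)
qed

text \<open>Objects are subsets of one fixed type, which need not contain a copy of a product
  \<open>A \<times> B\<close>. Along an injection the pullback can instead be taken to be the preimage of the image of
  that injection, which is a subset of \<open>A\<close>.\<close>

lemma set_pullback_along_injection:
  fixes f h :: "'u \<Rightarrow> 'u"
  assumes f: "f \<in> A \<rightarrow>\<^sub>E C" and h: "h \<in> B \<rightarrow>\<^sub>E C" and inj: "inj_on h B"
  defines "P \<equiv> {a \<in> A. f a \<in> h ` B}"
  shows "is_pullback set_cat (A, f, C) (B, h, C)
    (P, \<lambda>x\<in>P. x, A) (P, \<lambda>x\<in>P. the_inv_into B h (f x), B)"
  unfolding is_pullback_def
proof (intro conjI allI impI)
  define q where "q = (\<lambda>x\<in>P. the_inv_into B h (f x))"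
  have q: "q x \<in> B" "h (q x) = f x" if "x \<in> P" for x
    using that inj by (auto simp: q_def P_def the_inv_into_into f_the_inv_into_f)
  have PA: "P \<subseteq> A" by (auto simp: P_def)
  show "is_cospan set_cat (A, f, C) (B, h, C)" using f h by (simp add: is_cospan_def)
  have "q \<in> P \<rightarrow>\<^sub>E B" using q by (auto simp: q_def)
  then show "is_span_over set_cat (A, f, C) (B, h, C) (P, \<lambda>x\<in>P. x, A)
      (P, \<lambda>x\<in>P. the_inv_into B h (f x), B)"
    using q PA by (auto simp: is_span_over_def q_def[symmetric] compose_def fun_eq_iff)
  fix r s :: "'u set_arr"
  assume sp: "is_span_over set_cat (A, f, C) (B, h, C) r s"
  obtain R k A' where r: "r = (R, k, A')" by (cases r)
  obtain S l B' where s: "s = (S, l, B')" by (cases s)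
  have eqs: "S = R" "A' = A" "B' = B" and k: "k \<in> R \<rightarrow>\<^sub>E A" and l: "l \<in> R \<rightarrow>\<^sub>E B"
    and comp: "compose R f k = compose R h l"
    using sp by (auto simp: r s is_span_over_def)
  have fk: "f (k x) = h (l x)" if "x \<in> R" for x
    using fun_cong[OF comp, of x] that by (simp add: compose_def)
  have kP: "k x \<in> P" if "x \<in> R" for x
    using that k l fk[OF that] by (auto simp: P_def)
  have ql: "q (k x) = l x" if "x \<in> R" for x
    using inj_onD[OF inj, of "q (k x)" "l x"] q[OF kP[OF that]] fk[OF that] l that by auto
  have kRP: "k \<in> R \<rightarrow>\<^sub>E P" using k kP by (auto simp: PiE_iff)
  have unit: "compose R (\<lambda>x\<in>P. x) m = m" if "m \<in> R \<rightarrow>\<^sub>E P" for m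
    using that by (simp add: PiE_def Id_compose)
  have "compose R q k x = l x" for x
    using ql PiE_arb[OF l, of x] by (cases "x \<in> R") (simp_all add: compose_def)
  then have qk: "compose R q k = l" ..
  show "\<exists>!u. u \<in> Arr set_cat \<and> Src set_cat u = Src set_cat r \<and>
      Tgt set_cat u = Src set_cat (P, \<lambda>x\<in>P. x, A) \<and>
      Comp set_cat (P, \<lambda>x\<in>P. x, A) u = r \<and>
      Comp set_cat (P, \<lambda>x\<in>P. the_inv_into B h (f x), B) u = s"
    using kRP qk unit unfolding r s eqs q_def[symmetric]
    by (intro ex1I[of _ "(R, k, P)"]) auto
qed

section \<open>The bicoverings of sets\<close>

lemma set_bicovE:
  assumes "set_bicov f h"
  obtains A i C B j where "f = (A, i, C)" "h = (B, j, C)" "i \<in> A \<rightarrow>\<^sub>E C" "j \<in> B \<rightarrow>\<^sub>E C"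
    "inj_on i A" "inj_on j B" "i ` A \<union> j ` B = C"
  using assms by (cases f, cases h) (auto simp: set_bicov_def is_cospan_def)

lemma set_bicov_iff:
  "set_bicov (A, i, C) (B, j, C') \<longleftrightarrow> C' = C \<and> i \<in> A \<rightarrow>\<^sub>E C \<and> j \<in> B \<rightarrow>\<^sub>E C \<and>
     inj_on i A \<and> inj_on j B \<and> i ` A \<union> j ` B = C"
  by (auto simp: set_bicov_def is_cospan_def)

text \<open>The overlap \<open>P = A \<inter> B\<close>, which the second bicovering covers together with \<open>A'\<close>, already
  lies in \<open>B\<close>. Hence \<open>A'\<close> and \<open>B\<close> cover \<open>A \<union> B\<close>.\<close>

lemma set_bicov_comp:
  fixes f h :: "'u set_arr"
  assumes fh: "set_bicov f h" and pb: "is_pullback set_cat f h p q" and fp: "set_bicov f' p"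
  shows "set_bicov (Comp set_cat f f') h"
proof -
  from fh obtain A i C B j where f: "f = (A, i, C)" and h: "h = (B, j, C)"
    and ij: "i \<in> A \<rightarrow>\<^sub>E C" "j \<in> B \<rightarrow>\<^sub>E C" "inj_on i A" "inj_on j B" "i ` A \<union> j ` B = C"
    by (rule set_bicovE)
  from fp obtain A' i' D P k where f': "f' = (A', i', D)" and p: "p = (P, k, D)"
    and k: "i' \<in> A' \<rightarrow>\<^sub>E D" "k \<in> P \<rightarrow>\<^sub>E D" "inj_on i' A'" "i' ` A' \<union> k ` P = D"
    by (rule set_bicovE)
  obtain Q l E where q: "q = (Q, l, E)" by (cases q)
  note sq = set_pullback_commutes[OF pb[unfolded f h p q]]
  have D: "D = A" using sq(2) .
  have "i ` A \<subseteq> compose A' i i' ` A' \<union> j ` B"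
  proof -
    have "i (k t) \<in> j ` B" if "t \<in> P" for t using sq(5,6) that by auto
    moreover have "i (i' t) \<in> compose A' i i' ` A'" if "t \<in> A'" for t
      using that by (auto simp: compose_def)
    ultimately show ?thesis using k(4) D by blast
  qed
  moreover have "compose A' i i' \<in> A' \<rightarrow>\<^sub>E C"
    using k(1) ij(1) unfolding D by (rule compose_in_extensional_funcset)
  moreover have "inj_on (compose A' i i') A'"
    using k(1,3) ij(3) D by (auto simp: inj_on_def compose_def Pi_iff PiE_iff)
  ultimately show ?thesis
    using ij D unfolding f h f' by (auto simp: set_bicov_iff)
qed

lemma bicovered_category_set_cat:
  "bicovered_category (set_cat :: ('u set, 'u set_arr) cat) set_bicov"
proof (intro bicovered_category.intro category_set_cat bicovered_category_axioms.intro)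
  fix f h p q f' :: "'u set_arr"
  show "set_bicov f h \<Longrightarrow> is_cospan set_cat f h"
    by (auto simp: set_bicov_def)
  show "set_bicov f h \<Longrightarrow> set_bicov h f"
    by (auto elim!: set_bicovE simp: set_bicov_iff)
  show "set_bicov f h \<Longrightarrow> \<exists>p q. is_pullback set_cat f h p q"
    by (elim set_bicovE) (blast intro: set_pullback_along_injection)
  show "set_bicov f h \<Longrightarrow> is_pullback set_cat f h p q \<Longrightarrow> set_bicov f' p \<Longrightarrow>
      set_bicov (Comp set_cat f f') h"
    by (rule set_bicov_comp)
qed

text \<open>A right inverse of the induced map of overlaps makes it surjective: every point of
  \<open>A \<inter> B\<close> comes from a point of \<open>A' \<inter> B'\<close>. Points of an overlap are written here as
  pairs \<open>(a, b)\<close> with the same image in the union.\<close>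

lemma bicov_morphism_lifts_overlap:
  fixes f h :: "'u \<Rightarrow> 'u"
  assumes mor: "bicov_morphism set_cat (A', f', C') (B', h', D') (A, f, C) (B, h, D)
      (A1, qa, A2) (B1, qb, B2) qc"
    and ab: "a \<in> A" "b \<in> B" "f a = h b"
  obtains a' b' where "a' \<in> A'" "b' \<in> B'" "f' a' = h' b'" "qa a' = a" "qb b' = b"
proof -
  from mor obtain p' q' p q u s where
      pb': "is_pullback set_cat (A', f', C') (B', h', D') p' q'"
      and pb: "is_pullback set_cat (A, f, C) (B, h, D) p q"
      and u: "Src set_cat u = Src set_cat p'"
        "Comp set_cat p u = Comp set_cat (A1, qa, A2) p'"
        "Comp set_cat q u = Comp set_cat (B1, qb, B2) q'"
      and s: "s \<in> Arr set_cat" "Src set_cat s = Src set_cat p" "Tgt set_cat s = Src set_cat p'"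
        "Comp set_cat u s = Ident set_cat (Src set_cat p)"
    unfolding bicov_morphism_def by blast
  obtain P' k' E1 where p': "p' = (P', k', E1)" by (cases p')
  obtain Q' l' E2 where q': "q' = (Q', l', E2)" by (cases q')
  obtain P k E3 where p: "p = (P, k, E3)" by (cases p)
  obtain Q l E4 where q: "q = (Q, l, E4)" by (cases q)
  obtain U1 v U2 where v: "u = (U1, v, U2)" by (cases u)
  obtain S1 w S2 where w: "s = (S1, w, S2)" by (cases s)
  note sq' = set_pullback_commutes[OF pb'[unfolded p' q']]
  obtain t where t: "t \<in> P" "k t = a" "l t = b"
    using set_pullback_element[OF pb[unfolded p q] ab] .
  have wt: "w t \<in> P'" using s(1-3) t(1) by (auto simp: w p p')
  have "compose P v w = (\<lambda>x\<in>P. x)" using s by (auto simp: w p v)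
  from fun_cong[OF this, of t] t(1) have vw: "v (w t) = t" by (simp add: compose_def)
  have "compose P' k v = compose P' qa k'" "compose P' l v = compose P' qb l'"
    using u sq'(1) by (auto simp: p q v p' q')
  from this[THEN fun_cong, of "w t"] wt have "k (v (w t)) = qa (k' (w t))" "l (v (w t)) = qb (l' (w t))"
    by (simp_all add: compose_def)
  then have "qa (k' (w t)) = a" "qb (l' (w t)) = b" using vw t by simp_all
  moreover have "k' (w t) \<in> A'" "l' (w t) \<in> B'" "f' (k' (w t)) = h' (l' (w t))"
    using sq'(4-6) wt by auto
  ultimately show thesis using that by blast
qed

section \<open>The presheaf of topologies\<close>

lemma topologies_iff:
  "\<tau> \<in> topologies A \<longleftrightarrow> \<tau> \<subseteq> Pow A \<and> A \<in> \<tau> \<and> (\<forall>S\<in>\<tau>. \<forall>T\<in>\<tau>. S \<inter> T \<in> \<tau>) \<and> (\<forall>\<K>\<subseteq>\<tau>. \<Union>\<K> \<in> \<tau>)"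
  by (auto simp: topologies_def istopology_def)

lemma topologiesD:
  assumes "\<tau> \<in> topologies A"
  shows "\<And>U. U \<in> \<tau> \<Longrightarrow> U \<subseteq> A" "A \<in> \<tau>" "\<And>S T. S \<in> \<tau> \<Longrightarrow> T \<in> \<tau> \<Longrightarrow> S \<inter> T \<in> \<tau>"
    "\<And>\<K>. \<K> \<subseteq> \<tau> \<Longrightarrow> \<Union>\<K> \<in> \<tau>"
  using assms by (auto simp: topologies_iff)

lemma topology_preimage_image: "topology_preimage (A, f, B) \<tau> = (\<lambda>U. f -` U \<inter> A) ` \<tau>"
  by (auto simp: topology_preimage_def)

lemma topology_preimage_iff:
  "V \<in> topology_preimage (A, f, B) \<tau> \<longleftrightarrow> (\<exists>U\<in>\<tau>. V = f -` U \<inter> A)"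
  by (auto simp: topology_preimage_def)

lemma topology_preimage_in_topologies:
  assumes f: "f \<in> A \<rightarrow> B" and \<tau>: "\<tau> \<in> topologies B"
  shows "topology_preimage (A, f, B) \<tau> \<in> topologies A"
  unfolding topologies_iff
proof (intro conjI ballI allI impI)
  note T = topologiesD[OF \<tau>]
  show "topology_preimage (A, f, B) \<tau> \<subseteq> Pow A" by (auto simp: topology_preimage_iff)
  have "A = f -` B \<inter> A" using f by auto
  then show "A \<in> topology_preimage (A, f, B) \<tau>" using T(2) by (auto simp: topology_preimage_iff)
  show "S \<inter> S' \<in> topology_preimage (A, f, B) \<tau>"
    if "S \<in> topology_preimage (A, f, B) \<tau>" "S' \<in> topology_preimage (A, f, B) \<tau>" for S S'
  proof -
    from that obtain U U' where U: "U \<in> \<tau>" "S = f -` U \<inter> A" "U' \<in> \<tau>" "S' = f -` U' \<inter> A"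
      by (auto simp: topology_preimage_iff)
    then have "S \<inter> S' = f -` (U \<inter> U') \<inter> A" by auto
    moreover have "U \<inter> U' \<in> \<tau>" using U T(3) by simp
    ultimately show ?thesis unfolding topology_preimage_iff by (rule bexI)
  qed
  show "\<Union>\<K> \<in> topology_preimage (A, f, B) \<tau>" if K: "\<K> \<subseteq> topology_preimage (A, f, B) \<tau>" for \<K>
  proof -
    \<comment> \<open>Taking all open sets whose preimage lies in the family avoids choosing one for each member.\<close>
    let ?L = "{U \<in> \<tau>. f -` U \<inter> A \<in> \<K>}"
    have "\<exists>U\<in>?L. V = f -` U \<inter> A" if "V \<in> \<K>" for V
      using K that by (fastforce simp: topology_preimage_iff)
    then have "\<Union>\<K> = f -` \<Union>?L \<inter> A" by blast
    moreover have "\<Union>?L \<in> \<tau>" by (rule T(4)) auto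
    ultimately show ?thesis unfolding topology_preimage_iff by (rule bexI)
  qed
qed

lemma set_presheaf_topologies:
  "set_presheaf (set_cat :: ('u set, 'u set_arr) cat) topologies topology_preimage"
proof (intro set_presheaf.intro category_set_cat set_presheaf_axioms.intro)
  fix f g :: "'u set_arr" and a :: "'u set" and x :: "'u set set"
  obtain A F B where f: "f = (A, F, B)" by (cases f)
  obtain B' G D where g: "g = (B', G, D)" by (cases g)
  show "f \<in> Arr set_cat \<Longrightarrow>
      topology_preimage f \<in> topologies (Tgt set_cat f) \<rightarrow> topologies (Src set_cat f)"
    by (auto simp: f intro!: topology_preimage_in_topologies)
  show "topology_preimage (Ident set_cat a) x = x" if "x \<in> topologies a"
  proof -
    have "(\<lambda>y\<in>a. y) -` U \<inter> a = U" if "U \<in> x" for U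
      using topologiesD(1)[OF \<open>x \<in> topologies a\<close> that] by auto
    then show ?thesis by (auto simp: topology_preimage_iff)
  qed
  show "topology_preimage (Comp set_cat g f) x = topology_preimage f (topology_preimage g x)"
    if "f \<in> Arr set_cat" "Tgt set_cat f = Src set_cat g"
  proof -
    have "compose A G F -` U \<inter> A = F -` (G -` U \<inter> B') \<inter> A" for U
      using that by (auto simp: f g compose_def)
    then show ?thesis by (simp add: f g topology_preimage_image image_image)
  qed
qed

section \<open>Gluing topologies\<close>

lemma topology_glue_iff:
  "U \<in> topology_glue (A, i, C) (B, j, C') (x, y) \<longleftrightarrow> U \<subseteq> C \<and> i -` U \<inter> A \<in> x \<and> j -` U \<inter> B \<in> y"
  by (simp add: topology_glue_def)

lemma topology_glue_in_topologies:
  assumes i: "i \<in> A \<rightarrow> C" and j: "j \<in> B \<rightarrow> C" and x: "x \<in> topologies A" and y: "y \<in> topologies B"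
  shows "topology_glue (A, i, C) (B, j, C) (x, y) \<in> topologies C"
  unfolding topologies_iff
proof (intro conjI ballI allI impI)
  note X = topologiesD[OF x] and Y = topologiesD[OF y]
  let ?W = "topology_glue (A, i, C) (B, j, C) (x, y)"
  show sub: "?W \<subseteq> Pow C" by (auto simp: topology_glue_iff)
  have "i -` C \<inter> A = A" "j -` C \<inter> B = B" using i j by auto
  then show "C \<in> ?W" using X(2) Y(2) by (simp add: topology_glue_iff)
  show "S \<inter> T \<in> ?W" if "S \<in> ?W" "T \<in> ?W" for S T
  proof -
    have "i -` (S \<inter> T) \<inter> A = (i -` S \<inter> A) \<inter> (i -` T \<inter> A)"
      "j -` (S \<inter> T) \<inter> B = (j -` S \<inter> B) \<inter> (j -` T \<inter> B)" by auto
    then show ?thesis using that X(3) Y(3) by (auto simp only: topology_glue_iff)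
  qed
  show "\<Union>\<K> \<in> ?W" if "\<K> \<subseteq> ?W" for \<K>
  proof -
    have "i -` \<Union>\<K> \<inter> A = \<Union>((\<lambda>U. i -` U \<inter> A) ` \<K>)"
      "j -` \<Union>\<K> \<inter> B = \<Union>((\<lambda>U. j -` U \<inter> B) ` \<K>)" by auto
    moreover have "\<Union>((\<lambda>U. i -` U \<inter> A) ` \<K>) \<in> x" "\<Union>((\<lambda>U. j -` U \<inter> B) ` \<K>) \<in> y"
      using that by (intro X(4) Y(4) image_subsetI; auto simp: topology_glue_iff)+
    moreover have "\<Union>\<K> \<subseteq> C" using that sub by blast
    ultimately show ?thesis by (simp add: topology_glue_iff)
  qed
qed

lemma topology_glue_swap:
  "topology_glue (B, j, C) (A, i, C) (y, x) = topology_glue (A, i, C) (B, j, C) (x, y)"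
  by (auto simp: topology_glue_iff)

text \<open>The overlap of \<open>A\<close> with \<open>B \<subseteq> A\<close> is \<open>B\<close>, so matching says that \<open>y\<close> is the topology
  induced by \<open>x\<close>. The condition on the trace on \<open>B\<close> is then implied by the one on \<open>A\<close>.\<close>

lemma topology_glue_identity:
  fixes h :: "'u \<Rightarrow> 'u"
  assumes h: "h \<in> B \<rightarrow>\<^sub>E A"
    and m: "(x, y) \<in> matching set_cat topologies topology_preimage (Ident set_cat A) (B, h, A)"
  shows "topology_glue (Ident set_cat A) (B, h, A) (x, y) = x"
proof -
  have x: "x \<in> topologies A" and y: "y \<in> topologies B" using m by (auto simp: matching_def)
  have "is_pullback set_cat (Ident set_cat A) (B, h, A) (B, h, A) (Ident set_cat B)"
    using category.pullback_of_identity[OF category_set_cat, of "(B, h, A)"] h by simp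
  then have "topology_preimage (B, h, A) x = topology_preimage (Ident set_cat B) y"
    using m by (auto simp: matching_def)
  also have "\<dots> = y"
    using set_presheaf.GM_Ident[OF set_presheaf_topologies, of B y] y by simp
  finally have hy: "h -` U \<inter> B \<in> y" if "U \<in> x" for U
    using that by (auto simp: topology_preimage_image)
  have "(\<lambda>z\<in>A. z) -` U \<inter> A = U" if "U \<subseteq> A" for U using that by auto
  then show ?thesis
    using hy topologiesD(1)[OF x] by (auto simp: topology_glue_iff)
qed

lemma topology_glue_back_and_forth:
  fixes x y :: "'u set set"
  assumes i: "i \<in> A \<rightarrow> C" and j: "j \<in> B \<rightarrow> C" and i': "i' \<in> A' \<rightarrow> A"
  defines "W \<equiv> topology_glue (A', compose A' i i', C) (B, j, C) (x, y)"
  shows "topology_glue (A, i, C) (B, j, C)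
      (topology_preimage (A, i, C) W, topology_preimage (B, j, C) W) = W"
proof (intro equalityI subsetI)
  fix U assume "U \<in> topology_glue (A, i, C) (B, j, C)
      (topology_preimage (A, i, C) W, topology_preimage (B, j, C) W)"
  then obtain S T where U: "U \<subseteq> C" and S: "S \<in> W" "i -` U \<inter> A = i -` S \<inter> A"
    and T: "T \<in> W" "j -` U \<inter> B = j -` T \<inter> B"
    by (auto simp: topology_glue_iff topology_preimage_iff)
  have "compose A' i i' -` U \<inter> A' = i' -` (i -` U \<inter> A) \<inter> A'" for U
    using i' by (auto simp: compose_def)
  then have "compose A' i i' -` U \<inter> A' = compose A' i i' -` S \<inter> A'" by (simp only: S(2))
  with U S(1) T show "U \<in> W" by (simp add: W_def topology_glue_iff)
next
  fix U assume "U \<in> W"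
  then show "U \<in> topology_glue (A, i, C) (B, j, C)
      (topology_preimage (A, i, C) W, topology_preimage (B, j, C) W)"
    by (auto simp: topology_preimage_iff topology_glue_iff W_def)
qed

text \<open>A point of \<open>A\<close> outside \<open>S\<close> could lie in the union for two reasons: it has the same image as a
  point of \<open>S\<close>, which injectivity of \<open>i\<close> excludes, or as a point of \<open>T\<close>, which the agreement on the
  overlap excludes.\<close>

lemma glue_subsets:
  assumes "inj_on i A" "inj_on j B" "S \<subseteq> A" "T \<subseteq> B"
    and agree: "\<And>a b. a \<in> A \<Longrightarrow> b \<in> B \<Longrightarrow> i a = j b \<Longrightarrow> a \<in> S \<longleftrightarrow> b \<in> T"
  shows "i -` (i ` S \<union> j ` T) \<inter> A = S" "j -` (i ` S \<union> j ` T) \<inter> B = T"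
proof -
  show "i -` (i ` S \<union> j ` T) \<inter> A = S"
  proof (intro equalityI subsetI)
    fix a assume a: "a \<in> i -` (i ` S \<union> j ` T) \<inter> A"
    then consider s where "s \<in> S" "i a = i s" | t where "t \<in> T" "i a = j t" by auto
    then show "a \<in> S"
    proof cases
      case 1 then show ?thesis using inj_onD[OF assms(1), of a s] a assms(3) by auto
    next
      case 2 then show ?thesis using agree[of a t] a assms(4) by auto
    qed
  qed (use assms(3) in auto)
  show "j -` (i ` S \<union> j ` T) \<inter> B = T"
  proof (intro equalityI subsetI)
    fix b assume b: "b \<in> j -` (i ` S \<union> j ` T) \<inter> B"
    then consider s where "s \<in> S" "i s = j b" | t where "t \<in> T" "j b = j t" by force
    then show "b \<in> T"
    proof cases
      case 1 then show ?thesis using agree[of s b] b assms(3) by auto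
    next
      case 2 then show ?thesis using inj_onD[OF assms(2), of b t] b assms(4) by auto
    qed
  qed (use assms(4) in auto)
qed

text \<open>The inclusion from left to right holds for every commuting triple of maps. The converse needs
  the lifting of overlap points: it transports the agreement of the two traces of \<open>V\<close> on the upper
  overlap to agreement of \<open>S\<close> and \<open>T\<close> on the lower one.\<close>

lemma topology_glue_natural:
  assumes ij: "i \<in> A \<rightarrow> C" "j \<in> B \<rightarrow> C" "inj_on i A" "inj_on j B"
    and ij': "i' ` A' \<union> j' ` B' = C'"
    and q: "qa \<in> A' \<rightarrow> A" "qb \<in> B' \<rightarrow> B" "qc \<in> C' \<rightarrow> C"
    and comm: "\<And>a. a \<in> A' \<Longrightarrow> qc (i' a) = i (qa a)" "\<And>b. b \<in> B' \<Longrightarrow> qc (j' b) = j (qb b)"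
    and lift: "\<And>a b. a \<in> A \<Longrightarrow> b \<in> B \<Longrightarrow> i a = j b \<Longrightarrow>
      \<exists>a'\<in>A'. \<exists>b'\<in>B'. i' a' = j' b' \<and> qa a' = a \<and> qb b' = b"
    and x: "x \<subseteq> Pow A" and y: "y \<subseteq> Pow B"
  shows "topology_preimage (C', qc, C) (topology_glue (A, i, C) (B, j, C) (x, y)) =
    topology_glue (A', i', C') (B', j', C')
      (topology_preimage (A', qa, A) x, topology_preimage (B', qb, B) y)"
    (is "?L = ?R")
proof (intro equalityI subsetI)
  fix V assume "V \<in> ?L"
  then obtain U where V: "V = qc -` U \<inter> C'" and U: "i -` U \<inter> A \<in> x" "j -` U \<inter> B \<in> y"
    by (auto simp: topology_preimage_iff topology_glue_iff)
  have "i' a \<in> V \<longleftrightarrow> i (qa a) \<in> U" "qa a \<in> A" if "a \<in> A'" for a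
    using that V ij' comm(1)[OF that] q(1) by auto
  then have "i' -` V \<inter> A' = qa -` (i -` U \<inter> A) \<inter> A'" by blast
  moreover have "j' b \<in> V \<longleftrightarrow> j (qb b) \<in> U" "qb b \<in> B" if "b \<in> B'" for b
    using that V ij' comm(2)[OF that] q(2) by auto
  then have "j' -` V \<inter> B' = qb -` (j -` U \<inter> B) \<inter> B'" by blast
  moreover have "V \<subseteq> C'" using V by simp
  ultimately show "V \<in> ?R"
    using U unfolding topology_preimage_iff topology_glue_iff by blast
next
  fix V assume "V \<in> ?R"
  then obtain S T where VC: "V \<subseteq> C'" and S: "S \<in> x" "i' -` V \<inter> A' = qa -` S \<inter> A'"
    and T: "T \<in> y" "j' -` V \<inter> B' = qb -` T \<inter> B'"
    by (auto simp: topology_preimage_iff topology_glue_iff)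
  have ST: "S \<subseteq> A" "T \<subseteq> B" using S(1) T(1) x y by auto
  have VS: "i' a' \<in> V \<longleftrightarrow> qa a' \<in> S" if "a' \<in> A'" for a' using S(2) that by blast
  have VT: "j' b' \<in> V \<longleftrightarrow> qb b' \<in> T" if "b' \<in> B'" for b' using T(2) that by blast
  have agree: "a \<in> S \<longleftrightarrow> b \<in> T" if ab: "a \<in> A" "b \<in> B" "i a = j b" for a b
  proof -
    obtain a' b' where "a' \<in> A'" "b' \<in> B'" "i' a' = j' b'" "qa a' = a" "qb b' = b"
      using lift[OF ab] by blast
    then show ?thesis using VS[of a'] VT[of b'] by simp
  qed
  define U where "U = i ` S \<union> j ` T"
  have traces: "i -` U \<inter> A = S" "j -` U \<inter> B = T"
    unfolding U_def using glue_subsets[OF ij(3,4) ST] agree by blast+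
  have US: "i a \<in> U \<longleftrightarrow> a \<in> S" if "a \<in> A" for a using traces(1) that by blast
  have UT: "j b \<in> U \<longleftrightarrow> b \<in> T" if "b \<in> B" for b using traces(2) that by blast
  have "U \<subseteq> C" using ST ij(1,2) by (auto simp: U_def)
  then have "U \<in> topology_glue (A, i, C) (B, j, C) (x, y)"
    using S(1) T(1) by (simp only: topology_glue_iff traces)
  moreover have "V = qc -` U \<inter> C'"
  proof -
    have "c \<in> V \<longleftrightarrow> qc c \<in> U" if "c \<in> C'" for c
    proof -
      from that ij' consider a where "a \<in> A'" "c = i' a" | b where "b \<in> B'" "c = j' b" by blast
      then show ?thesis
      proof cases
        case 1
        then show ?thesis using VS comm(1) US[of "qa a"] q(1) by (simp add: Pi_iff)
      next
        case 2
        then show ?thesis using VT comm(2) UT[of "qb b"] q(2) by (simp add: Pi_iff)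
      qed
    qed
    with VC show ?thesis by blast
  qed
  ultimately show "V \<in> ?L" by (auto simp: topology_preimage_iff)
qed

lemma topology_glue_partial_naturality:
  fixes f h f' h' :: "'u set_arr"
  assumes fh': "set_bicov f' h'" and fh: "set_bicov f h"
    and mor: "bicov_morphism set_cat f' h' f h ra rb rc"
    and m: "(x, y) \<in> matching set_cat topologies topology_preimage f h"
  shows "topology_preimage rc (topology_glue f h (x, y)) =
    topology_glue f' h' (topology_preimage ra x, topology_preimage rb y)"
proof -
  from fh obtain A i C B j where f: "f = (A, i, C)" and h: "h = (B, j, C)"
    and ij: "i \<in> A \<rightarrow>\<^sub>E C" "j \<in> B \<rightarrow>\<^sub>E C" "inj_on i A" "inj_on j B"
    by (rule set_bicovE)
  from fh' obtain A' i' C' B' j' where f': "f' = (A', i', C')" and h': "h' = (B', j', C')"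
    and ij': "i' ` A' \<union> j' ` B' = C'"
    by (rule set_bicovE)
  have "ra \<in> Arr set_cat" "Src set_cat ra = A'" "Tgt set_cat ra = A"
    "rb \<in> Arr set_cat" "Src set_cat rb = B'" "Tgt set_cat rb = B"
    "rc \<in> Arr set_cat" "Src set_cat rc = C'" "Tgt set_cat rc = C"
    using mor by (simp_all add: bicov_morphism_def f h f' h')
  then obtain qa qb qc where ra: "ra = (A', qa, A)" and rb: "rb = (B', qb, B)" and rc: "rc = (C', qc, C)"
    and q: "qa \<in> A' \<rightarrow>\<^sub>E A" "qb \<in> B' \<rightarrow>\<^sub>E B" "qc \<in> C' \<rightarrow>\<^sub>E C"
    by (cases ra, cases rb, cases rc) auto
  have sq: "compose A' qc i' = compose A' i qa" "compose B' qc j' = compose B' j qb"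
    using mor by (simp_all add: bicov_morphism_def f h f' h' ra rb rc)
  have comm: "qc (i' a) = i (qa a)" if "a \<in> A'" for a
    using fun_cong[OF sq(1), of a] that by (simp add: compose_def)
  have comm': "qc (j' b) = j (qb b)" if "b \<in> B'" for b
    using fun_cong[OF sq(2), of b] that by (simp add: compose_def)
  have lift: "\<exists>a'\<in>A'. \<exists>b'\<in>B'. i' a' = j' b' \<and> qa a' = a \<and> qb b' = b"
    if "a \<in> A" "b \<in> B" "i a = j b" for a b
    using bicov_morphism_lifts_overlap[OF mor[unfolded f h f' h' ra rb] that] by blast
  have "x \<subseteq> Pow A" "y \<subseteq> Pow B"
    using m topologiesD(1) by (auto simp: matching_def f h)
  then show ?thesis
    unfolding f h f' h' ra rb rc
    using ij q by (intro topology_glue_natural ij' comm comm' lift) auto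
qed

theorem proposition5p4p1:
  shows "gleaf (set_cat :: ('u set, 'u set_arr) cat) set_bicov
           topologies topology_preimage topology_glue"
proof (intro gleaf.intro bicovered_category_set_cat set_presheaf_topologies gleaf_axioms.intro)
  let ?M = "matching (set_cat :: ('u set, 'u set_arr) cat) topologies topology_preimage"
  fix f h p q f' h' ra rb rc :: "'u set_arr" and a b :: "'u set" and x y :: "'u set set"
  show "topology_glue f h \<in> ?M f h \<rightarrow> topologies (Tgt set_cat f)" if "set_bicov f h"
    using that by (elim set_bicovE) (auto simp: matching_def intro!: topology_glue_in_topologies)
  show swap: "topology_glue h f (y, x) = topology_glue f h (x, y)" if "set_bicov f h" for f h x y
    using that by (elim set_bicovE) (simp add: topology_glue_swap)
  show identity: "topology_glue (Ident set_cat a) h (x, y) = x"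
    if "set_bicov (Ident set_cat a) h" "(x, y) \<in> ?M (Ident set_cat a) h" for a h x y
    using that by (cases h) (auto simp: set_bicov_iff intro!: topology_glue_identity[unfolded set_cat_simps])
  show "topology_glue f (Ident set_cat b) (x, y) = y"
    if "set_bicov f (Ident set_cat b)" "(x, y) \<in> ?M f (Ident set_cat b)"
  proof -
    have "set_bicov (Ident set_cat b) f"
      using bicovered_category.bicov_swap[OF bicovered_category_set_cat that(1)] .
    then show ?thesis using identity[OF _ matching_swap[OF that(2)]] swap[OF that(1)] by simp
  qed
  show "topology_glue f h
      (topology_preimage f (topology_glue (Comp set_cat f f') h (x, y)),
       topology_preimage h (topology_glue (Comp set_cat f f') h (x, y)))
      = topology_glue (Comp set_cat f f') h (x, y)"
    if fh: "set_bicov f h" and pb: "is_pullback set_cat f h p q" and fp: "set_bicov f' p"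
  proof -
    from fh obtain A i C B j where f: "f = (A, i, C)" and h: "h = (B, j, C)"
      and ij: "i \<in> A \<rightarrow>\<^sub>E C" "j \<in> B \<rightarrow>\<^sub>E C"
      by (rule set_bicovE)
    have "f' \<in> Arr set_cat" "Tgt set_cat f' = A"
      using fp pb by (auto simp: set_bicov_def is_cospan_def is_pullback_def is_span_over_def f)
    then obtain A' i' where f': "f' = (A', i', A)" and i': "i' \<in> A' \<rightarrow>\<^sub>E A"
      by (cases f') auto
    show ?thesis
      using ij i' unfolding f h f' set_cat_simps by (intro topology_glue_back_and_forth) auto
  qed
  show "topology_preimage rc (topology_glue f h (x, y)) =
      topology_glue f' h' (topology_preimage ra x, topology_preimage rb y)"
    if "set_bicov f' h'" "set_bicov f h" "bicov_morphism set_cat f' h' f h ra rb rc"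
      "(x, y) \<in> ?M f h"
    using topology_glue_partial_naturality[OF that] .
qed

end
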